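(* Let $\Omega$ be a bounded domain in $\mathbb{C}^n$, $p\in\Omega$, and $\{\phi_j\}\subset\mathrm{Aut}(\Omega)$ a sequence such that $\{\phi_j(p)\}$ converges to some point of $\partial\Omega$. Let $\{\psi_j\}\subset\mathrm{Aut}(\mathbb{C}^n)$ converge to $\widehat\psi\in\mathrm{Aut}(\mathbb{C}^n)$ uniformly on compact subsets of $\mathbb{C}^n$, and let $\{D_j\}$ be a sequence of $\mathbb{C}$-affine maps. If the Pinchuk scaling sequence $\{D_j\circ\psi_j\circ\phi_j\}$ built upon $\{\psi_j\}$ converges, uniformly on compact subsets of $\Omega$, to a biholomorphism $\widehat\sigma$ of $\Omega$ into $\mathbb{C}^n$, then the modified Frankel scaling sequence $\{\omega_j\}$ by $\{\psi_j\}$ converges, uniformly on compact subsets of $\widehat\psi(\Omega)$, to a map $\widehat\omega$, and $$\widehat\omega = \widehat A\circ\widehat\sigma\circ\widehat\psi^{-1}$$ for some nonsingular $\mathbb{C}$-affine map $\widehat A$ of $\mathbb{C}^n$.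
   Context: $\mathrm{Aut}(M)$ denotes the group of biholomorphic self-maps of $M$. "Biholomorphism into" means biholomorphism onto its image. The modified Frankel scaling sequence by $\{\psi_j\}$ is the sequence of maps $\omega_j:\psi_j(\Omega)\to\mathbb{C}^n$, $$\omega_j(\mathbf z) := [d(\psi_j\circ\phi_j\circ\psi_j^{-1})|_{\psi_j(p)}]^{-1}\big(\psi_j\circ\phi_j\circ\psi_j^{-1}(\mathbf z)-\psi_j\circ\phi_j(p)\big).$$ Every compact subset of $\widehat\psi(\Omega)$ is contained in $\psi_j(\Omega)$ for all large $j$. *)

theory Defs
  imports "HOL-Analysis.Analysis"
begin

text \<open>Complex n-space is \<^typ>\<open>complex ^ 'n\<close>. Since \<^const>\<open>has_derivative\<close> is the real Frechet
  derivative, complex linearity is imposed separately, with respect to the complex scalar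
  multiplication \<open>*s\<close>.\<close>

abbreviation complex_linear :: "(complex ^ 'n \<Rightarrow> complex ^ 'm) \<Rightarrow> bool"
  where "complex_linear \<equiv> Vector_Spaces.linear (*s) (*s)"

definition holomorphic_map_on :: "(complex ^ 'n \<Rightarrow> complex ^ 'm) \<Rightarrow> (complex ^ 'n) set \<Rightarrow> bool"
  where "holomorphic_map_on f S \<longleftrightarrow>
    open S \<and> (\<forall>z\<in>S. \<exists>L. complex_linear L \<and> (f has_derivative L) (at z))"

definition biholomorphic_map :: "(complex ^ 'n \<Rightarrow> complex ^ 'n) \<Rightarrow> (complex ^ 'n) set \<Rightarrow> (complex ^ 'n) set \<Rightarrow> bool"
  where "biholomorphic_map f S T \<longleftrightarrow>
    bij_betw f S T \<and> holomorphic_map_on f S \<and> holomorphic_map_on (inv_into S f) T"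

definition biholomorphism_into :: "(complex ^ 'n \<Rightarrow> complex ^ 'n) \<Rightarrow> (complex ^ 'n) set \<Rightarrow> bool"
  where "biholomorphism_into f S \<longleftrightarrow> biholomorphic_map f S (f ` S)"

text \<open>Maps are total functions; only their values on \<open>S\<close> are constrained by membership in \<open>Aut S\<close>.\<close>

definition Aut :: "(complex ^ 'n) set \<Rightarrow> (complex ^ 'n \<Rightarrow> complex ^ 'n) set"
  where "Aut S = {f. biholomorphic_map f S S}"

definition complex_affine :: "(complex ^ 'n \<Rightarrow> complex ^ 'n) \<Rightarrow> bool"
  where "complex_affine A \<longleftrightarrow> (\<exists>L b. complex_linear L \<and> A = (\<lambda>z. L z + b))"

definition nonsingular_complex_affine :: "(complex ^ 'n \<Rightarrow> complex ^ 'n) \<Rightarrow> bool"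
  where "nonsingular_complex_affine A \<longleftrightarrow> (\<exists>L b. complex_linear L \<and> bij L \<and> A = (\<lambda>z. L z + b))"

text \<open>Uniform convergence on compact subsets of \<open>U\<close> for maps \<open>F j\<close> whose domain of definition
  is \<open>V j\<close>: each compact subset of \<open>U\<close> must lie in \<open>V j\<close> for all large \<open>j\<close>, so the
  meaningless values of the total function \<open>F j\<close> outside \<open>V j\<close> play no role in the limit.\<close>

definition converges_on_compacts ::
  "(nat \<Rightarrow> (complex ^ 'n) set) \<Rightarrow> (nat \<Rightarrow> complex ^ 'n \<Rightarrow> complex ^ 'n) \<Rightarrow>
   (complex ^ 'n \<Rightarrow> complex ^ 'n) \<Rightarrow> (complex ^ 'n) set \<Rightarrow> bool"
  where "converges_on_compacts V F f U \<longleftrightarrow>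
    (\<forall>K. compact K \<and> K \<subseteq> U \<longrightarrow>
       (\<forall>\<^sub>F j in sequentially. K \<subseteq> V j) \<and> uniform_limit K F f sequentially)"

text \<open>One term of the modified Frankel scaling sequence, to be read as a map on \<open>\<psi> ` \<Omega>\<close>.\<close>

definition modified_frankel ::
  "complex ^ 'n \<Rightarrow> (complex ^ 'n \<Rightarrow> complex ^ 'n) \<Rightarrow> (complex ^ 'n \<Rightarrow> complex ^ 'n) \<Rightarrow>
   complex ^ 'n \<Rightarrow> complex ^ 'n"
  where "modified_frankel p \<psi> \<phi> z =
    inv (frechet_derivative (\<psi> \<circ> \<phi> \<circ> inv \<psi>) (at (\<psi> p)))
      ((\<psi> \<circ> \<phi> \<circ> inv \<psi>) z - (\<psi> \<circ> \<phi>) p)"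

end

theory Submission
  imports Defs "HOL-Complex_Analysis.Cauchy_Integral_Formula"
begin

text \<open>
  Write \<open>\<tau>\<^sub>j = D\<^sub>j \<circ> \<psi>\<^sub>j \<circ> \<phi>\<^sub>j\<close>, and let \<open>S\<^sub>j\<close>, \<open>P\<^sub>j\<close>, \<open>S'\<close>, \<open>P'\<close> be the derivatives at
  \<open>p\<close> of \<open>\<tau>\<^sub>j\<close>, \<open>\<psi>\<^sub>j\<close>, \<open>\<sigma>\<close>, \<open>\<psi>'\<close>. The Frankel normalization is unchanged when the map is
  composed on the left with an invertible affine map, so the chain rule turns the Frankel sequence into
  \<open>\<omega>\<^sub>j(z) = P\<^sub>j (S\<^sub>j\<^sup>-\<^sup>1 (\<tau>\<^sub>j(\<psi>\<^sub>j\<^sup>-\<^sup>1(z)) - \<tau>\<^sub>j(p)))\<close> as soon as \<open>S\<^sub>j\<close> is invertible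
  (\<open>modified_frankel_eq\<close>). Every factor on the right converges locally uniformly, so the limit is
  \<open>P' (S'\<^sup>-\<^sup>1 (\<sigma>(\<psi>'\<^sup>-\<^sup>1(z)) - \<sigma>(p)))\<close>, which exhibits the affine map.

  Two convergence facts carry this. The derivatives converge because holomorphic maps satisfy
  Cauchy estimates on the complex lines through \<open>p\<close> (\<open>uniform_limit_derivatives\<close>). Both
  \<open>\<psi>\<^sub>j\<^sup>-\<^sup>1\<close> and \<open>S\<^sub>j\<^sup>-\<^sup>1\<close> converge because locally uniform convergence of homeomorphisms of a Euclidean
  space passes to the inverses. This is purely topological: if \<open>f\<close> is close to a homeomorphism \<open>F\<close>
  on compact sets, then \<open>F\<^sup>-\<^sup>1 \<circ> f\<close> is close to the identity, and Brouwer's fixed point theorem solves \<open>f x = w\<close> near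
  \<open>F\<^sup>-\<^sup>1(w)\<close> (\<open>eventually_nearby_solution\<close>). The same solvability shows that \<open>S\<^sub>j\<close> is surjective, hence
  invertible, for large \<open>j\<close>.
\<close>

section \<open>Composition of locally uniformly convergent sequences\<close>

lemma image_eventually_in_compact:
  fixes f :: "nat \<Rightarrow> 'a::topological_space \<Rightarrow> 'b::heine_borel"
  assumes "compact K" and lim: "uniform_limit K f F sequentially" and "continuous_on K F"
    and "F ` K \<subseteq> W" and "open W"
  obtains N where "compact N" and "N \<subseteq> W" and "F ` K \<subseteq> N" and "\<forall>\<^sub>F j in sequentially. f j ` K \<subseteq> N"
proof -
  have cFK: "compact (F ` K)"
    using assms by (intro compact_continuous_image)
  then obtain e where e: "e > 0" "(\<Union>x\<in>F ` K. cball x e) \<subseteq> W"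
    using compact_subset_open_imp_cball_epsilon_subset[OF cFK \<open>open W\<close> \<open>F ` K \<subseteq> W\<close>] by blast
  define N where "N = (\<Union>x\<in>F ` K. cball x e)"
  have "\<forall>\<^sub>F j in sequentially. f j ` K \<subseteq> N"
    using uniform_limitD[OF lim \<open>e > 0\<close>]
  proof eventually_elim
    case (elim j)
    then have "f j x \<in> cball (F x) e" if "x \<in> K" for x
      using that by (simp add: dist_commute less_imp_le)
    then show ?case
      unfolding N_def by blast
  qed
  moreover have "F ` K \<subseteq> N"
    using \<open>e > 0\<close> unfolding N_def by (intro subsetI UN_I) auto
  moreover have "compact N"
    unfolding N_def by (rule compact_minkowski_sum_cball[OF cFK])
  ultimately show thesis
    using that e(2) N_def by blast
qed

text \<open>
  Both the outer maps \<open>g j\<close> and the inner maps \<open>f j\<close> vary. The images \<open>f j ` K\<close> eventually stay in a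
  single compact subset of \<open>W\<close>; there \<open>g j\<close> converges uniformly, and the limit \<open>G\<close> is
  uniformly continuous.
\<close>

lemma uniform_limit_compose_varying:
  fixes f :: "nat \<Rightarrow> 'a::topological_space \<Rightarrow> 'b::heine_borel"
    and g :: "nat \<Rightarrow> 'b \<Rightarrow> 'c::metric_space"
  assumes "compact K" and limf: "uniform_limit K f F sequentially" and "continuous_on K F"
    and "F ` K \<subseteq> W" and "open W"
    and limg: "\<And>N. compact N \<Longrightarrow> N \<subseteq> W \<Longrightarrow> uniform_limit N g G sequentially"
    and contG: "continuous_on W G"
  shows "uniform_limit K (\<lambda>j x. g j (f j x)) (\<lambda>x. G (F x)) sequentially"
proof -
  obtain N where N: "compact N" "N \<subseteq> W" "F ` K \<subseteq> N" "\<forall>\<^sub>F j in sequentially. f j ` K \<subseteq> N"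
    using image_eventually_in_compact[OF assms(1-5)] .
  show ?thesis
    unfolding uniform_limit_iff
  proof (intro allI impI)
    fix e :: real assume "e > 0"
    have "uniformly_continuous_on N G"
      using N contG compact_uniformly_continuous continuous_on_subset by blast
    then obtain d where d: "d > 0" "\<And>x y. x \<in> N \<Longrightarrow> y \<in> N \<Longrightarrow> dist x y < d \<Longrightarrow> dist (G x) (G y) < e / 2"
      using \<open>e > 0\<close> unfolding uniformly_continuous_on_def by (metis half_gt_zero)
    have "\<forall>\<^sub>F j in sequentially. \<forall>y\<in>N. dist (g j y) (G y) < e / 2"
      using uniform_limitD[OF limg[OF N(1,2)], of "e / 2"] \<open>e > 0\<close> by linarith
    then show "\<forall>\<^sub>F j in sequentially. \<forall>x\<in>K. dist (g j (f j x)) (G (F x)) < e"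
      using uniform_limitD[OF limf d(1)] N(4)
    proof eventually_elim
      case (elim j)
      show ?case
      proof
        fix x assume "x \<in> K"
        then have "f j x \<in> N" "F x \<in> N"
          using elim(3) N(3) by auto
        then have "dist (g j (f j x)) (G (f j x)) < e / 2" "dist (G (f j x)) (G (F x)) < e / 2"
          using elim \<open>x \<in> K\<close> d(2) by auto
        then show "dist (g j (f j x)) (G (F x)) < e"
          by (metis dist_commute dist_triangle_half_l)
      qed
    qed
  qed
qed

section \<open>Convergence of inverse maps\<close>

text \<open>
  A solution of \<open>f j x = w\<close> is a fixed point of \<open>x \<mapsto> x - inv F (f j x) + inv F w\<close>. On a compact
  neighbourhood of \<open>inv F ` K\<close> the maps \<open>inv F \<circ> f j\<close> converge uniformly to the identity, so for large
  \<open>j\<close> this map sends every ball of radius \<open>e\<close> about a point of \<open>inv F ` K\<close> into itself, and Brouwer's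
  theorem applies.
\<close>

lemma eventually_nearby_solution:
  fixes f :: "nat \<Rightarrow> 'a::euclidean_space \<Rightarrow> 'a"
  assumes contf: "\<And>j. continuous_on UNIV (f j)" and contF: "continuous_on UNIV F"
    and "bij F" and contG: "continuous_on UNIV (inv F)"
    and lim: "\<And>K. compact K \<Longrightarrow> uniform_limit K f F sequentially"
    and "compact K" and "e > 0"
  shows "\<forall>\<^sub>F j in sequentially. \<forall>w\<in>K. \<exists>x\<in>cball (inv F w) e. f j x = w"
proof -
  let ?G = "inv F"
  define N where "N = (\<Union>x\<in>?G ` K. cball x e)"
  have "compact N"
    unfolding N_def using \<open>compact K\<close> contG
    by (intro compact_minkowski_sum_cball compact_continuous_image) (auto intro: continuous_on_subset)
  have "uniform_limit N (\<lambda>j x. ?G (f j x)) (\<lambda>x. ?G (F x)) sequentially"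
    by (rule uniform_limit_compose_varying[where W = UNIV and f = f and F = F and g = "\<lambda>_. ?G" and G = ?G])
      (use \<open>compact N\<close> lim contF contG in \<open>auto intro: continuous_on_subset uniform_limit_const\<close>)
  from uniform_limitD[OF this \<open>e > 0\<close>] show ?thesis
  proof eventually_elim
    case (elim j)
    show ?case
    proof
      fix w assume "w \<in> K"
      define T where "T = (\<lambda>x. x - ?G (f j x) + ?G w)"
      have "continuous_on (cball (?G w) e) T"
        unfolding T_def
        by (intro continuous_intros continuous_on_compose2[OF contG] continuous_on_subset[OF contf]) auto
      moreover have "T \<in> cball (?G w) e \<rightarrow> cball (?G w) e"
      proof
        fix x assume "x \<in> cball (?G w) e"
        then have "x \<in> N"
          using \<open>w \<in> K\<close> by (auto simp: N_def)
        with elim have "dist (?G (f j x)) (?G (F x)) < e"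
          by blast
        then show "T x \<in> cball (?G w) e"
          using \<open>bij F\<close> by (simp add: T_def dist_norm bij_is_inj algebra_simps norm_minus_commute)
      qed
      ultimately obtain x where "x \<in> cball (?G w) e" "T x = x"
        using brouwer_ball \<open>e > 0\<close> by blast
      moreover from this have "?G (f j x) = ?G w"
        by (simp add: T_def algebra_simps)
      ultimately show "\<exists>x\<in>cball (?G w) e. f j x = w"
        using bij_is_inj[OF bij_imp_bij_inv[OF \<open>bij F\<close>]] by (metis injD)
    qed
  qed
qed

lemma uniform_limit_inverses:
  fixes f :: "nat \<Rightarrow> 'a::euclidean_space \<Rightarrow> 'a"
  assumes contf: "\<And>j. continuous_on UNIV (f j)" and contF: "continuous_on UNIV F"
    and "bij F" and contG: "continuous_on UNIV (inv F)"
    and lim: "\<And>K. compact K \<Longrightarrow> uniform_limit K f F sequentially"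
    and inj: "\<forall>\<^sub>F j in sequentially. inj (f j)" and "compact K"
  shows "uniform_limit K (\<lambda>j. inv (f j)) (inv F) sequentially"
  unfolding uniform_limit_iff
proof (intro allI impI)
  fix e :: real assume "e > 0"
  then have "\<forall>\<^sub>F j in sequentially. \<forall>w\<in>K. \<exists>x\<in>cball (inv F w) (e / 2). f j x = w"
    by (intro eventually_nearby_solution contf contF \<open>bij F\<close> contG lim \<open>compact K\<close>) auto
  then
  show "\<forall>\<^sub>F j in sequentially. \<forall>w\<in>K. dist (inv (f j) w) (inv F w) < e"
    using inj
  proof eventually_elim
    case (elim j)
    show ?case
    proof
      fix w assume "w \<in> K"
      with elim obtain x where "x \<in> cball (inv F w) (e / 2)" "f j x = w"
        by blast
      then show "dist (inv (f j) w) (inv F w) < e"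
        using elim(2) \<open>e > 0\<close> inv_f_f[of "f j" x] by (auto simp: dist_commute)
    qed
  qed
qed

text \<open>
  This is the openness of the set of invertible operators. Solvability of \<open>f j x = w\<close> for all \<open>w\<close> in the unit
  ball gives surjectivity by scaling, hence bijectivity, since the dimension is finite.
\<close>

lemma linear_eventually_bij:
  fixes f :: "nat \<Rightarrow> 'a::euclidean_space \<Rightarrow> 'a"
  assumes linf: "\<And>j. linear (f j)" and "linear F" and "bij F"
    and lim: "\<And>K. compact K \<Longrightarrow> uniform_limit K f F sequentially"
  shows "\<forall>\<^sub>F j in sequentially. bij (f j)"
proof -
  have "linear (inv F)"
    using assms by (simp add: bij_is_inj inj_linear_imp_inv_linear)
  then have "\<forall>\<^sub>F j in sequentially. \<forall>w\<in>cball 0 1. \<exists>x\<in>cball (inv F w) 1. f j x = w"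
    using assms by (intro eventually_nearby_solution linear_continuous_on linear_linear[THEN iffD2]) auto
  then show ?thesis
  proof eventually_elim
    case (elim j)
    have "surj (f j)"
      unfolding surj_def
    proof
      fix y :: 'a
      obtain x where "f j x = y /\<^sub>R (norm y)"
        using elim[rule_format, of "y /\<^sub>R (norm y)"] by (cases "y = 0") auto
      then have "y = f j (norm y *\<^sub>R x)"
        using linf[of j] by (cases "y = 0") (auto simp: linear_scale linear_0)
      then show "\<exists>x. y = f j x" ..
    qed
    then show "bij (f j)"
      using linf[of j] by (simp add: bij_def linear_surjective_imp_injective)
  qed
qed

section \<open>Complex linear and holomorphic maps\<close>

lemma norm_vector_scalar_mult: "norm (c *s x) = norm c * norm x"
  for x :: "'a::real_normed_div_algebra ^ 'n"
  by (simp add: norm_vec_def vector_scalar_mult_def norm_mult L2_set_right_distrib)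

lemma complex_linear_imp_linear:
  assumes "complex_linear L" shows "linear L"
proof -
  interpret Vector_Spaces.linear "(*s)" "(*s)" L by fact
  have sc: "r *\<^sub>R x = complex_of_real r *s x" for r and x :: "complex ^ 'k"
    by (simp add: vec_eq_iff scaleR_conv_of_real[where 'a = complex])
  show ?thesis
    by (rule linearI) (simp_all add: add sc scale)
qed

lemma complex_linear_inv:
  assumes "complex_linear L" and "bij L"
  shows "complex_linear (inv L)"
proof -
  interpret Vector_Spaces.linear "(*s)" "(*s)" L by fact
  have "inv L (x + y) = inv L x + inv L y" "inv L (c *s x) = c *s inv L x" for x y c
    using \<open>bij L\<close> by (auto intro!: inv_f_eq simp: bij_is_inj add scale bij_is_surj surj_f_inv_f)
  then show ?thesis
    by unfold_locales auto
qed

lemma holomorphic_map_on_diff: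
  assumes "holomorphic_map_on f S" and "holomorphic_map_on g S"
  shows "holomorphic_map_on (\<lambda>z. f z - g z) S"
  unfolding holomorphic_map_on_def
proof (intro conjI ballI)
  show "open S" using assms by (simp add: holomorphic_map_on_def)
next
  fix z assume "z \<in> S"
  then obtain L M where "complex_linear L" "(f has_derivative L) (at z)"
    "complex_linear M" "(g has_derivative M) (at z)"
    using assms unfolding holomorphic_map_on_def by metis
  then show "\<exists>L. complex_linear L \<and> ((\<lambda>z. f z - g z) has_derivative L) (at z)"
    by (intro exI[of _ "\<lambda>v. L v - M v"] conjI has_derivative_diff vec.linear_compose_sub)
qed

lemma holomorphic_map_on_compose:
  assumes "holomorphic_map_on f S" and "holomorphic_map_on g T" and "f ` S \<subseteq> T"
  shows "holomorphic_map_on (g \<circ> f) S"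
  unfolding holomorphic_map_on_def
proof (intro conjI ballI)
  show "open S" using assms by (simp add: holomorphic_map_on_def)
next
  fix z assume "z \<in> S"
  then have "f z \<in> T" using assms by auto
  with \<open>z \<in> S\<close> obtain L M where "complex_linear L" "(f has_derivative L) (at z)"
    "complex_linear M" "(g has_derivative M) (at (f z))"
    using assms unfolding holomorphic_map_on_def by metis
  then show "\<exists>L. complex_linear L \<and> ((g \<circ> f) has_derivative L) (at z)"
    by (intro exI[of _ "M \<circ> L"] conjI diff_chain_at Vector_Spaces.linear_compose)
qed

lemma holomorphic_map_on_imp_continuous_on:
  assumes "holomorphic_map_on f S" shows "continuous_on S f"
  using assms unfolding holomorphic_map_on_def
  by (metis continuous_at_imp_continuous_on has_derivative_continuous)

lemma complex_affine_holomorphic: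
  assumes "complex_affine A" shows "holomorphic_map_on A UNIV"
proof -
  obtain L b where L: "complex_linear L" "A = (\<lambda>z. L z + b)"
    using assms unfolding complex_affine_def by blast
  then have "bounded_linear L"
    using complex_linear_imp_linear linear_conv_bounded_linear by blast
  then have "(A has_derivative L) (at z)" for z
    unfolding L(2) by (auto intro!: derivative_eq_intros bounded_linear_imp_has_derivative)
  with L(1) show ?thesis
    unfolding holomorphic_map_on_def by auto
qed

section \<open>Convergence of derivatives\<close>

text \<open>
  The one-variable Cauchy inequality applies to each component of \<open>t \<mapsto> f (p + t *s v)\<close> on the
  disc of radius \<open>r / norm v\<close>. The factor \<open>CARD('m)\<close> comes from bounding the Euclidean norm by the sum of
  the moduli of the components.
\<close>

lemma cauchy_estimate_derivative:
  fixes f :: "complex ^ 'n \<Rightarrow> complex ^ 'm"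
  assumes hol: "holomorphic_map_on f U" and "r > 0" and sub: "cball p r \<subseteq> U"
    and bound: "\<And>z. z \<in> cball p r \<Longrightarrow> norm (f z) \<le> B"
    and der: "(f has_derivative L) (at p)"
  shows "norm (L v) \<le> real CARD('m) * (B / r) * norm v"
proof (cases "v = 0")
  case True
  then show ?thesis using has_derivative_bounded_linear[OF der]
    by (simp add: bounded_linear.linear linear_0)
next
  case False
  define R where "R = r / norm v"
  have "R > 0" using False \<open>r > 0\<close> by (simp add: R_def)
  have in_ball: "p + t *s v \<in> cball p r" if "norm t \<le> R" for t
    using that False by (simp add: R_def dist_norm norm_vector_scalar_mult field_simps)
  have comp: "norm (L v $ i) \<le> (B / r) * norm v" for i
  proof -
    define h where "h = (\<lambda>t. f (p + t *s v) $ i)"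
    have h_der: "(h has_field_derivative M v $ i) (at t)"
      if "(f has_derivative M) (at (p + t *s v))" "complex_linear M" for M t
    proof -
      have bl: "bounded_linear (\<lambda>t. t *s v)"
        by (rule linear_conv_bounded_linear[THEN iffD1], rule linearI)
          (auto simp: vec_eq_iff algebra_simps)
      have "((\<lambda>t. p + t *s v) has_derivative (\<lambda>t. t *s v)) (at t)"
        using bounded_linear_imp_has_derivative[OF bl] by (auto intro!: derivative_eq_intros)
      from diff_chain_at[OF this that(1)]
      have "((f \<circ> (\<lambda>t. p + t *s v)) has_derivative (M \<circ> (\<lambda>t. t *s v))) (at t)" .
      from bounded_linear.has_derivative[OF bounded_linear_vec_nth this, of i]
      have "(h has_derivative (\<lambda>s. M (s *s v) $ i)) (at t)"
        by (simp add: h_def o_def)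
      moreover have "M (s *s v) $ i = M v $ i * s" for s
        using that(2) by (simp add: vec.linear_scale Vector_Spaces.linear_iff)
      ultimately show ?thesis
        by (simp add: has_field_derivative_def)
    qed
    have h_diff: "h field_differentiable (at t)" if "norm t \<le> R" for t
      using hol sub in_ball[OF that] h_der unfolding holomorphic_map_on_def field_differentiable_def
      by blast
    obtain M where M: "complex_linear M" "(f has_derivative M) (at p)"
      using hol sub \<open>r > 0\<close> unfolding holomorphic_map_on_def by (metis centre_in_cball less_imp_le subsetD)
    then have "M = L"
      using der has_derivative_unique by blast
    then have "deriv h 0 = L v $ i"
      using h_der[of M 0] M by (simp add: DERIV_imp_deriv)
    moreover have "norm ((deriv ^^ 1) h 0) \<le> fact 1 * B / R ^ 1"
    proof (rule Cauchy_inequality)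
      show "h holomorphic_on ball 0 R"
        using h_diff by (auto simp: holomorphic_on_def intro: field_differentiable_at_within)
      show "continuous_on (cball 0 R) h"
        using h_diff by (intro continuous_at_imp_continuous_on ballI field_differentiable_imp_continuous_at) auto
      show "norm (h t) \<le> B" if "norm (0 - t) = R" for t
      proof -
        have "norm (h t) \<le> norm (f (p + t *s v))"
          unfolding h_def by (rule Finite_Cartesian_Product.norm_nth_le)
        also have "\<dots> \<le> B"
          using that by (intro bound in_ball) simp
        finally show ?thesis .
      qed
    qed (use \<open>R > 0\<close> in auto)
    ultimately show ?thesis
      using False by (simp add: R_def)
  qed
  have "norm (L v) \<le> (\<Sum>i\<in>UNIV. norm (L v $ i))"
    unfolding norm_vec_def by (intro L2_set_le_sum) simp
  also have "\<dots> \<le> real CARD('m) * ((B / r) * norm v)"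
    using comp by (intro sum_bounded_above)
  finally show ?thesis by (simp add: mult.assoc)
qed

text \<open>
  The several-variable form of the Weierstrass theorem on derivatives, at a single point: the Cauchy
  estimate is applied to the differences \<open>f j - F\<close>.
\<close>

lemma uniform_limit_derivatives:
  fixes f :: "nat \<Rightarrow> complex ^ 'n \<Rightarrow> complex ^ 'm"
  assumes holf: "\<And>j. holomorphic_map_on (f j) U" and holF: "holomorphic_map_on F U"
    and lim: "\<And>K. compact K \<Longrightarrow> K \<subseteq> U \<Longrightarrow> uniform_limit K f F sequentially"
    and "p \<in> U" and derf: "\<And>j. (f j has_derivative f' j) (at p)" and derF: "(F has_derivative F') (at p)"
    and "compact K"
  shows "uniform_limit K f' F' sequentially"
  unfolding uniform_limit_iff
proof (intro allI impI)
  fix e :: real assume "e > 0"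
  have "open U" using holF by (simp add: holomorphic_map_on_def)
  then obtain r where r: "r > 0" "cball p r \<subseteq> U"
    using \<open>p \<in> U\<close> open_contains_cball by blast
  obtain b where b: "b > 0" "\<And>v. v \<in> K \<Longrightarrow> norm v \<le> b"
    using compact_imp_bounded[OF \<open>compact K\<close>] bounded_pos by blast
  let ?c = "real CARD('m)"
  have c: "?c > 0" by simp
  \<comment> \<open>\<open>B\<close> is chosen so that the Cauchy estimate yields \<open>e / 2\<close> on vectors of norm at most \<open>b\<close>.\<close>
  define B where "B = e * r / (2 * ?c * b)"
  have "B > 0" using \<open>e > 0\<close> r b c by (simp add: B_def)
  from uniform_limitD[OF lim[OF compact_cball r(2)] this]
  show "\<forall>\<^sub>F j in sequentially. \<forall>v\<in>K. dist (f' j v) (F' v) < e"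
  proof eventually_elim
    case (elim j)
    show ?case
    proof
      fix v assume "v \<in> K"
      have "norm (f' j v - F' v) \<le> ?c * (B / r) * norm v"
        by (rule cauchy_estimate_derivative[OF holomorphic_map_on_diff[OF holf[of j] holF] r])
          (use elim in \<open>auto simp: dist_norm less_imp_le intro!: has_derivative_diff derf derF\<close>)
      also have "\<dots> \<le> ?c * (B / r) * b"
        using b(2)[OF \<open>v \<in> K\<close>] \<open>B > 0\<close> r by (intro mult_left_mono) auto
      also have "\<dots> = e / 2"
        using r b c by (simp add: B_def field_simps)
      also have "\<dots> < e" using \<open>e > 0\<close> by simp
      finally show "dist (f' j v) (F' v) < e"
        by (simp add: dist_norm)
    qed
  qed
qed

text \<open>
  The derivative of \<open>inv_into S f\<close> at \<open>f z\<close> is a left inverse of the derivative of \<open>f\<close> at \<open>z\<close>; in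
  finite dimension a left inverse is the inverse.
\<close>

lemma biholomorphic_map_derivative:
  assumes "biholomorphic_map f S T" and "z \<in> S"
  obtains L where "complex_linear L" and "bij L" and "(f has_derivative L) (at z)"
    and "(inv_into S f has_derivative inv L) (at (f z))"
proof -
  let ?g = "inv_into S f"
  have bij: "bij_betw f S T" and S: "open S" and hol: "holomorphic_map_on f S" "holomorphic_map_on ?g T"
    using assms by (auto simp: biholomorphic_map_def holomorphic_map_on_def)
  have "f z \<in> T" using bij \<open>z \<in> S\<close> by (auto simp: bij_betw_def)
  with \<open>z \<in> S\<close> obtain L M where L: "complex_linear L" "(f has_derivative L) (at z)"
    and M: "(?g has_derivative M) (at (f z))"
    using hol unfolding holomorphic_map_on_def by metis
  have "((?g \<circ> f) has_derivative (M \<circ> L)) (at z)"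
    by (rule diff_chain_at[OF L(2) M])
  moreover have "((?g \<circ> f) has_derivative id) (at z)"
    by (rule has_derivative_transform_within_open[OF has_derivative_id S \<open>z \<in> S\<close>])
      (use bij in \<open>auto simp: bij_betw_def\<close>)
  ultimately have left_inv: "M \<circ> L = id"
    by (rule has_derivative_unique)
  have "linear L" by (rule complex_linear_imp_linear) fact
  have "inj L" using left_inv by (metis inj_on_id inj_on_imageI2)
  with \<open>linear L\<close> have "bij L"
    by (simp add: bij_def linear_injective_imp_surjective)
  moreover from left_inv \<open>bij L\<close> have "M = inv L"
    by (metis bij_is_surj comp_id fun.map_comp o_assoc surj_iff id_comp)
  ultimately show thesis
    using that L M by blast
qed

section \<open>The Frankel sequence in terms of the Pinchuk sequence\<close>

text \<open>
  The derivative of \<open>\<psi> \<circ> \<phi> \<circ> inv \<psi>\<close> at \<open>\<psi> p\<close> is \<open>Q \<circ> inv P\<close>, with inverse \<open>P \<circ> inv Q\<close>. Inserting the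
  linear part \<open>L\<close> of \<open>D\<close> by \<open>inv Q = inv (L \<circ> Q) \<circ> L\<close> replaces \<open>Q\<close>, which may degenerate along
  a sequence of maps \<open>\<phi>\<close>, by the derivative \<open>L \<circ> Q\<close> of the scaled map; the translation part of \<open>D\<close> cancels in the difference.
\<close>

lemma modified_frankel_eq:
  assumes "bij \<psi>" and "complex_linear L" and D: "D = (\<lambda>z. L z + b)"
    and derQ: "((\<psi> \<circ> \<phi>) has_derivative Q) (at p)" and "bij Q"
    and derP: "(inv \<psi> has_derivative inv P) (at (\<psi> p))" and "bij P"
    and S: "bij (L \<circ> Q)"
  shows "modified_frankel p \<psi> \<phi> z
    = P (inv (L \<circ> Q) ((D \<circ> \<psi> \<circ> \<phi>) (inv \<psi> z) - (D \<circ> \<psi> \<circ> \<phi>) p))"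
proof -
  define y where "y = (\<psi> \<circ> \<phi>) (inv \<psi> z) - (\<psi> \<circ> \<phi>) p"
  have "inv \<psi> (\<psi> p) = p"
    using \<open>bij \<psi>\<close> by (simp add: bij_is_inj)
  then have "((\<psi> \<circ> \<phi>) has_derivative Q) (at (inv \<psi> (\<psi> p)))"
    using derQ by simp
  from diff_chain_at[OF derP this]
  have "frechet_derivative (\<psi> \<circ> \<phi> \<circ> inv \<psi>) (at (\<psi> p)) = Q \<circ> inv P"
    by (rule frechet_derivative_at[symmetric])
  then have "modified_frankel p \<psi> \<phi> z = inv (Q \<circ> inv P) y"
    by (simp add: modified_frankel_def y_def)
  also have "\<dots> = P (inv Q y)"
    using \<open>bij P\<close> \<open>bij Q\<close> by (simp add: o_inv_distrib bij_imp_bij_inv inv_inv_eq)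
  also have "inv Q y = inv (L \<circ> Q) (L y)"
  proof -
    have "(L \<circ> Q) (inv Q y) = L y"
      using \<open>bij Q\<close> by (simp add: bij_is_surj surj_f_inv_f)
    then show ?thesis
      using S by (metis bij_inv_eq_iff)
  qed
  also have "L y = (D \<circ> \<psi> \<circ> \<phi>) (inv \<psi> z) - (D \<circ> \<psi> \<circ> \<phi>) p"
    using complex_linear_imp_linear[OF \<open>complex_linear L\<close>] by (simp add: y_def D linear_diff)
  finally show ?thesis .
qed

section \<open>Convergence of the Frankel sequence\<close>

theorem theorem4p1:
  fixes \<Omega> :: "(complex ^ 'n) set" and p :: "complex ^ 'n"
    and \<phi> \<psi> D :: "nat \<Rightarrow> complex ^ 'n \<Rightarrow> complex ^ 'n"
    and \<psi>' \<sigma> :: "complex ^ 'n \<Rightarrow> complex ^ 'n"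
  assumes "open \<Omega>" and "connected \<Omega>" and "bounded \<Omega>" and "p \<in> \<Omega>"
    and "\<And>j. \<phi> j \<in> Aut \<Omega>"
    and "\<exists>q\<in>frontier \<Omega>. (\<lambda>j. \<phi> j p) \<longlonglongrightarrow> q"
    and "\<And>j. \<psi> j \<in> Aut UNIV" and "\<psi>' \<in> Aut UNIV"
    and "converges_on_compacts (\<lambda>j. UNIV) \<psi> \<psi>' UNIV"
    and "\<And>j. complex_affine (D j)"
    and "biholomorphism_into \<sigma> \<Omega>"
    and "converges_on_compacts (\<lambda>j. \<Omega>) (\<lambda>j. D j \<circ> \<psi> j \<circ> \<phi> j) \<sigma> \<Omega>"
  shows "\<exists>\<omega>. converges_on_compacts (\<lambda>j. \<psi> j ` \<Omega>) (\<lambda>j. modified_frankel p (\<psi> j) (\<phi> j)) \<omega> (\<psi>' ` \<Omega>)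
    \<and> (\<exists>A. nonsingular_complex_affine A \<and> (\<forall>z\<in>\<psi>' ` \<Omega>. \<omega> z = (A \<circ> \<sigma> \<circ> inv \<psi>') z))"
proof -
  define \<tau> where "\<tau> = (\<lambda>j. D j \<circ> \<psi> j \<circ> \<phi> j)"
  have lim_\<tau>: "uniform_limit K \<tau> \<sigma> sequentially" if "compact K" "K \<subseteq> \<Omega>" for K
    using assms(12) that by (simp add: converges_on_compacts_def \<tau>_def)
  have lim_\<psi>: "uniform_limit K \<psi> \<psi>' sequentially" if "compact K" for K
    using assms(9) that by (simp add: converges_on_compacts_def)
  have \<phi>: "biholomorphic_map (\<phi> j) \<Omega> \<Omega>" and \<psi>: "biholomorphic_map (\<psi> j) UNIV UNIV" for j
    using assms(5,7) by (auto simp: Aut_def)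
  have \<psi>': "biholomorphic_map \<psi>' UNIV UNIV" and \<sigma>: "biholomorphic_map \<sigma> \<Omega> (\<sigma> ` \<Omega>)"
    using assms(8,11) by (auto simp: Aut_def biholomorphism_into_def)
  have bij_\<psi>: "bij (\<psi> j)" and bij_\<psi>': "bij \<psi>'" for j
    using \<psi>[of j] \<psi>' by (auto simp: biholomorphic_map_def)
  have hol: "holomorphic_map_on (\<phi> j) \<Omega>" "\<phi> j ` \<Omega> = \<Omega>" "holomorphic_map_on (\<psi> j) UNIV"
      "holomorphic_map_on \<psi>' UNIV" "holomorphic_map_on (inv \<psi>') UNIV" "holomorphic_map_on \<sigma> \<Omega>" for j
    using \<phi>[of j] \<psi>[of j] \<psi>' \<sigma> by (auto simp: biholomorphic_map_def bij_betw_def)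

  have "\<exists>P. bij P \<and> (\<psi> j has_derivative P) (at p) \<and> (inv (\<psi> j) has_derivative inv P) (at (\<psi> j p))" for j
    using biholomorphic_map_derivative[OF \<psi>[of j] UNIV_I[of p]] by metis
  then obtain P where P: "\<And>j. bij (P j)" "\<And>j. (\<psi> j has_derivative P j) (at p)"
      "\<And>j. (inv (\<psi> j) has_derivative inv (P j)) (at (\<psi> j p))"
    by metis
  have "\<exists>Q. bij Q \<and> ((\<psi> j \<circ> \<phi> j) has_derivative Q) (at p)" for j
  proof -
    obtain M where M: "bij M" "(\<phi> j has_derivative M) (at p)"
      using biholomorphic_map_derivative[OF \<phi> \<open>p \<in> \<Omega>\<close>] by metis
    obtain N where N: "bij N" "(\<psi> j has_derivative N) (at (\<phi> j p))"
      using biholomorphic_map_derivative[OF \<psi> UNIV_I] by metis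
    show ?thesis
      using bij_comp[OF M(1) N(1)] diff_chain_at[OF M(2) N(2)] by blast
  qed
  then obtain Q where Q: "\<And>j. bij (Q j)" "\<And>j. ((\<psi> j \<circ> \<phi> j) has_derivative Q j) (at p)"
    by metis
  have "\<exists>L b. complex_linear L \<and> D j = (\<lambda>z. L z + b)" for j
    using assms(10)[of j] by (simp add: complex_affine_def)
  then obtain L b where L: "\<And>j. complex_linear (L j)" "\<And>j. D j = (\<lambda>z. L j z + b j)"
    by metis
  \<comment> \<open>By the chain rule \<open>S j\<close> is the derivative of \<open>\<tau> j\<close> at \<open>p\<close>; the linear part \<open>L j\<close>, and hence \<open>S j\<close>, may
    be singular for finitely many \<open>j\<close>.\<close>
  define S where "S = (\<lambda>j. L j \<circ> Q j)"
  have der_\<tau>: "(\<tau> j has_derivative S j) (at p)" for j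
  proof -
    have "bounded_linear (L j)"
      using L(1) complex_linear_imp_linear linear_conv_bounded_linear by blast
    from bounded_linear.has_derivative[OF this Q(2)[of j]]
    show ?thesis
      by (auto simp: \<tau>_def S_def L(2) o_def intro!: derivative_eq_intros)
  qed
  obtain S' where S': "complex_linear S'" "bij S'" "(\<sigma> has_derivative S') (at p)"
    using biholomorphic_map_derivative[OF \<sigma> \<open>p \<in> \<Omega>\<close>] by metis
  obtain P' where P': "complex_linear P'" "bij P'" "(\<psi>' has_derivative P') (at p)"
    using biholomorphic_map_derivative[OF \<psi>' UNIV_I] by metis

  have hol_\<tau>: "holomorphic_map_on (\<tau> j) \<Omega>" for j
  proof -
    have "holomorphic_map_on (\<psi> j \<circ> \<phi> j) \<Omega>"
      by (rule holomorphic_map_on_compose[OF hol(1,3)]) simp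
    then have "holomorphic_map_on (D j \<circ> (\<psi> j \<circ> \<phi> j)) \<Omega>"
      by (rule holomorphic_map_on_compose[OF _ complex_affine_holomorphic[OF assms(10)]]) simp
    then show ?thesis
      by (simp add: \<tau>_def o_assoc)
  qed
  have lim_S: "uniform_limit K S S' sequentially" if "compact K" for K
    by (rule uniform_limit_derivatives[OF hol_\<tau> hol(6) lim_\<tau> \<open>p \<in> \<Omega>\<close> der_\<tau> S'(3) that])
  have lim_P: "uniform_limit K P P' sequentially" if "compact K" for K
    by (rule uniform_limit_derivatives[OF hol(3,4) lim_\<psi> UNIV_I P(2) P'(3) that])
  have lin_S: "linear (S j)" for j
    using der_\<tau> has_derivative_bounded_linear bounded_linear.linear by blast
  have lin': "linear S'" "linear P'" "linear (inv S')"
    using S' P' by (auto intro: complex_linear_imp_linear complex_linear_inv)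
  have cont_lin: "continuous_on T F" if "linear F" for F :: "complex ^ 'n \<Rightarrow> complex ^ 'n" and T
    using that by (simp add: linear_continuous_on linear_linear)
  have bij_S: "\<forall>\<^sub>F j in sequentially. bij (S j)"
    by (rule linear_eventually_bij[OF lin_S lin'(1) S'(2) lim_S])
  have lim_inv_S: "uniform_limit K (\<lambda>j. inv (S j)) (inv S') sequentially" if "compact K" for K
    using bij_S by (intro uniform_limit_inverses cont_lin lin_S lin' S' lim_S that) (auto elim: eventually_mono simp: bij_is_inj)
  have lim_inv_\<psi>: "uniform_limit K (\<lambda>j. inv (\<psi> j)) (inv \<psi>') sequentially" if "compact K" for K
    using hol bij_\<psi> by (intro uniform_limit_inverses holomorphic_map_on_imp_continuous_on bij_\<psi>' lim_\<psi> that)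
      (auto simp: bij_is_inj)

  define A where "A = (\<lambda>w. P' (inv S' (w - \<sigma> p)))"
  have "nonsingular_complex_affine A"
    unfolding nonsingular_complex_affine_def
  proof (intro exI conjI)
    show "complex_linear (P' \<circ> inv S')"
      by (rule Vector_Spaces.linear_compose[OF complex_linear_inv[OF S'(1,2)] P'(1)])
    show "bij (P' \<circ> inv S')"
      using S' P' by (intro bij_comp bij_imp_bij_inv)
    show "A = (\<lambda>w. (P' \<circ> inv S') w + - P' (inv S' (\<sigma> p)))"
      by (simp add: A_def linear_diff lin')
  qed
  moreover have "converges_on_compacts (\<lambda>j. \<psi> j ` \<Omega>) (\<lambda>j. modified_frankel p (\<psi> j) (\<phi> j))
      (A \<circ> \<sigma> \<circ> inv \<psi>') (\<psi>' ` \<Omega>)"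
    unfolding converges_on_compacts_def
  proof (intro allI impI conjI)
    fix K assume K: "compact K \<and> K \<subseteq> \<psi>' ` \<Omega>"
    then have "compact K" by simp
    have sub: "inv \<psi>' ` K \<subseteq> \<Omega>"
      using K bij_\<psi>' by (auto simp: bij_is_inj)
    have cont_inv_\<psi>': "continuous_on K (inv \<psi>')"
      using holomorphic_map_on_imp_continuous_on[OF hol(5)] continuous_on_subset by blast
    have cont_\<sigma>: "continuous_on \<Omega> \<sigma>"
      by (rule holomorphic_map_on_imp_continuous_on[OF hol(6)])
    obtain N where N: "N \<subseteq> \<Omega>" "\<forall>\<^sub>F j in sequentially. inv (\<psi> j) ` K \<subseteq> N"
      using image_eventually_in_compact[OF \<open>compact K\<close> lim_inv_\<psi>[OF \<open>compact K\<close>] cont_inv_\<psi>' sub \<open>open \<Omega>\<close>]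
      by metis
    from N(2) show "\<forall>\<^sub>F j in sequentially. K \<subseteq> \<psi> j ` \<Omega>"
    proof eventually_elim
      case (elim j)
      show ?case
      proof
        fix z assume "z \<in> K"
        then have "inv (\<psi> j) z \<in> \<Omega>" using elim N(1) by blast
        moreover have "z = \<psi> j (inv (\<psi> j) z)"
          using bij_\<psi> by (simp add: bij_is_surj surj_f_inv_f)
        ultimately show "z \<in> \<psi> j ` \<Omega>" by blast
      qed
    qed
    have "uniform_limit K (\<lambda>j z. \<tau> j (inv (\<psi> j) z)) (\<lambda>z. \<sigma> (inv \<psi>' z)) sequentially"
      by (rule uniform_limit_compose_varying[OF \<open>compact K\<close> lim_inv_\<psi>[OF \<open>compact K\<close>] cont_inv_\<psi>' sub
            \<open>open \<Omega>\<close> lim_\<tau> cont_\<sigma>])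
    moreover have "uniform_limit K (\<lambda>j z. \<tau> j p) (\<lambda>z. \<sigma> p) sequentially"
      by (rule uniform_limit_compose'[OF lim_\<tau>[of "{p}"]]) (use \<open>p \<in> \<Omega>\<close> in auto)
    ultimately have lim: "uniform_limit K (\<lambda>j z. \<tau> j (inv (\<psi> j) z) - \<tau> j p)
        (\<lambda>z. \<sigma> (inv \<psi>' z) - \<sigma> p) sequentially"
      by (rule uniform_limit_minus)
    have cont: "continuous_on K (\<lambda>z. \<sigma> (inv \<psi>' z) - \<sigma> p)"
      using sub by (intro continuous_intros continuous_on_compose2[OF cont_\<sigma> cont_inv_\<psi>'])
    have "uniform_limit K (\<lambda>j z. inv (S j) (\<tau> j (inv (\<psi> j) z) - \<tau> j p))
        (\<lambda>z. inv S' (\<sigma> (inv \<psi>' z) - \<sigma> p)) sequentially"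
      by (rule uniform_limit_compose_varying[OF \<open>compact K\<close> lim cont subset_UNIV open_UNIV
            lim_inv_S cont_lin[OF lin'(3)]])
    then have "uniform_limit K (\<lambda>j z. P j (inv (S j) (\<tau> j (inv (\<psi> j) z) - \<tau> j p)))
        (\<lambda>z. P' (inv S' (\<sigma> (inv \<psi>' z) - \<sigma> p))) sequentially"
      by (rule uniform_limit_compose_varying[OF \<open>compact K\<close> _ _ subset_UNIV open_UNIV
            lim_P cont_lin[OF lin'(2)]])
        (auto intro: continuous_on_compose2[OF cont_lin[OF lin'(3)] cont])
    moreover have "\<forall>\<^sub>F j in sequentially. \<forall>z\<in>K.
        P j (inv (S j) (\<tau> j (inv (\<psi> j) z) - \<tau> j p)) = modified_frankel p (\<psi> j) (\<phi> j) z"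
      using bij_S
    proof eventually_elim
      case (elim j)
      show ?case
        unfolding S_def \<tau>_def
        by (rule ballI, rule modified_frankel_eq[symmetric, OF bij_\<psi> L Q(2,1) P(3,1) elim[unfolded S_def]])
    qed
    ultimately show "uniform_limit K (\<lambda>j. modified_frankel p (\<psi> j) (\<phi> j)) (A \<circ> \<sigma> \<circ> inv \<psi>') sequentially"
      using uniform_limit_cong[where F = sequentially and X = K] by (fastforce simp: A_def)
  qed
  ultimately show ?thesis
    by blast
qed

end
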